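(* Let $k\ge 1$ and let $F(z_1,\dots,z_k)$ be a nonzero Laurent polynomial with complex coefficients. Then $$\mathcal M(F)=\Big\{m(F_H) : H\in\bigcup_{\ell=0}^k\mathbb Z^{\ell\times k},\ H \text{ of rank } \ell \text{ (its number of rows) in Saturated Hermite Normal Form},\ F_H\neq 0\Big\}.$$
   Context: For a nonzero complex Laurent polynomial $G$ in $\ell\ge 0$ variables, its (logarithmic) Mahler measure is $$m(G)=\int_0^1\cdots\int_0^1\log|G(e^{2\pi i t_1},\dots,e^{2\pi i t_\ell})|\,dt_1\cdots dt_\ell,$$ so $m(G)=\log|G|$ when $\ell=0$ ($G$ a nonzero constant). For $\ell\ge 0$ and $A=(a_{ij})\in\mathbb Z^{\ell\times k}$, put $$(z_1,\dots,z_\ell)^A=(z_1^{a_{11}}\cdots z_\ell^{a_{\ell 1}},\ \dots,\ z_1^{a_{1k}}\cdots z_\ell^{a_{\ell k}}),$$ a $k$-tuple of monomials (equal to $(1,\dots,1)$ when $\ell=0$), and define $F_A(z_1,\dots,z_\ell)=F((z_1,\dots,z_\ell)^A)$. Define $$\mathcal M(F)=\{m(F_A) : A\in\mathbb Z^{\ell\times k},\ \ell\ge 0,\ F_A\neq 0\}.$$ A nonzero integer $\ell\times k$ matrix $A=(a_{ij})$ is in Hermite Normal Form (HNF) if: (1) for some integer $r$ with $0\le r<k$ the leftmost $r$ columns of $A$ are zero; (2) for some integer $s$ with $0\le s<\ell$ the bottom $s$ rows of $A$ are zero; (3) for $1\le i\le \ell-s$ there are integers $j_i$ with $r+1=j_1<j_2<\cdots<j_{\ell-s}\le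 k$ such that $a_{i,j_i}$ is a positive integer, $a_{ij'}=0$ for $j'<j_i$, and $0\le a_{i'j_i}<a_{i,j_i}$ for $i'<i$. A matrix $H\in\mathbb Z^{\ell\times k}$ is in Saturated Hermite Normal Form if $H$ is in HNF and the intersection with $\mathbb Z^k$ of the $\mathbb R$-vector space spanned by the rows of $H$ equals the integer lattice spanned by the rows of $H$. The empty matrix ($\ell=0$) is regarded as being of rank $0$ and in Saturated Hermite Normal Form. *)

theory Defs
  imports
    "HOL-Analysis.Analysis"
    "HOL-Library.Poly_Mapping"
    "Jordan_Normal_Form.DL_Rank"
begin

text \<open>
  A Laurent polynomial is an element of the group algebra of the free abelian group of exponent
  vectors: an exponent vector is a finitely supported function from variable indices to integers,
  and a Laurent polynomial assigns complex coefficients to finitely many exponent vectors.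
  Variables, rows and columns are all indexed from 0.
\<close>

type_synonym laurent = "(nat \<Rightarrow>\<^sub>0 int) \<Rightarrow>\<^sub>0 complex"

definition laurent_polys :: "nat \<Rightarrow> laurent set" where
  "laurent_polys k = {F. \<forall>e\<in>Poly_Mapping.keys F. Poly_Mapping.keys e \<subseteq> {..<k}}"

definition eval_laurent :: "laurent \<Rightarrow> (nat \<Rightarrow> complex) \<Rightarrow> complex" where
  "eval_laurent F z =
     (\<Sum>e\<in>Poly_Mapping.keys F. Poly_Mapping.lookup F e *
        (\<Prod>i\<in>Poly_Mapping.keys e. z i powi Poly_Mapping.lookup e i))"

text \<open>
  The domain is the product of \<open>l\<close> copies of Lebesgue measure on the unit interval, which
  for \<open>l = 0\<close> is a point mass. For nonzero \<open>G\<close> and \<open>l > 0\<close> the convention \<open>ln 0 = 0\<close> only affects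
  the zeros of \<open>G\<close>, a null set.
\<close>

definition mahler_measure :: "nat \<Rightarrow> laurent \<Rightarrow> real" where
  "mahler_measure l G =
     (\<integral>t. ln (cmod (eval_laurent G (\<lambda>i. exp (2 * of_real pi * \<i> * of_real (t i)))))
        \<partial>(\<Pi>\<^sub>M i\<in>{..<l}. restrict_space lborel {0..1::real}))"

text \<open>
  Substituting the monomial \<open>\<Prod>i. z i powi A $$ (i, j)\<close> for the \<open>j\<close>-th variable sends the monomial
  with exponent vector \<open>e\<close> to the one with exponent vector \<open>A e\<close>; distinct \<open>e\<close> may collide, and
  their coefficients are then added. See \<open>eval_laurent_subst\<close> below.
\<close>

definition mat_exponent :: "int mat \<Rightarrow> (nat \<Rightarrow>\<^sub>0 int) \<Rightarrow> (nat \<Rightarrow>\<^sub>0 int)" where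
  "mat_exponent A e =
     (\<Sum>i<dim_row A. Poly_Mapping.single i (\<Sum>j<dim_col A. A $$ (i, j) * Poly_Mapping.lookup e j))"

definition laurent_subst :: "laurent \<Rightarrow> int mat \<Rightarrow> laurent" where
  "laurent_subst F A =
     (\<Sum>e\<in>Poly_Mapping.keys F. Poly_Mapping.single (mat_exponent A e) (Poly_Mapping.lookup F e))"

definition mahler_set :: "nat \<Rightarrow> laurent \<Rightarrow> real set" where
  "mahler_set k F =
     {mahler_measure l (laurent_subst F A) | l A. A \<in> carrier_mat l k \<and> laurent_subst F A \<noteq> 0}"

text \<open>
  Here \<open>r\<close> counts the zero columns on the left, \<open>s\<close> the zero rows at the bottom, and \<open>p i\<close> is the
  column of the pivot of row \<open>i\<close>; with 0-based columns the first pivot is in column \<open>r\<close>.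
\<close>

definition hermite_normal_form :: "int mat \<Rightarrow> bool" where
  "hermite_normal_form A \<longleftrightarrow>
     A \<noteq> 0\<^sub>m (dim_row A) (dim_col A) \<and>
     (\<exists>r s p. r < dim_col A \<and> s < dim_row A \<and>
        (\<forall>i<dim_row A. \<forall>j<r. A $$ (i, j) = 0) \<and>
        (\<forall>i<dim_row A. \<forall>j<dim_col A. dim_row A - s \<le> i \<longrightarrow> A $$ (i, j) = 0) \<and>
        p 0 = r \<and> strict_mono_on {..<dim_row A - s} p \<and>
        (\<forall>i<dim_row A - s.
           p i < dim_col A \<and> A $$ (i, p i) > 0 \<and>
           (\<forall>j'<p i. A $$ (i, j') = 0) \<and>
           (\<forall>i'<i. 0 \<le> A $$ (i', p i) \<and> A $$ (i', p i) < A $$ (i, p i))))"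

definition saturated_hnf :: "int mat \<Rightarrow> bool" where
  "saturated_hnf H \<longleftrightarrow>
     dim_row H = 0 \<or>
     hermite_normal_form H \<and>
     {v \<in> carrier_vec (dim_col H).
        map_vec real_of_int v \<in>
          vec_space.row_space (dim_col H) (map_mat real_of_int H)} =
       vec_module.lattice_of (dim_col H) (rows H)"

lemma eval_laurent_add:
  "eval_laurent (F + G) z = eval_laurent F z + eval_laurent G z"
proof -
  define m where "m e = (\<Prod>i\<in>Poly_Mapping.keys e. z i powi Poly_Mapping.lookup e i)"
    for e :: "nat \<Rightarrow>\<^sub>0 int"
  define S where "S = Poly_Mapping.keys F \<union> Poly_Mapping.keys G"
  have *: "eval_laurent X z = (\<Sum>e\<in>S. Poly_Mapping.lookup X e * m e)"
    if "Poly_Mapping.keys X \<subseteq> S" for X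
    unfolding eval_laurent_def m_def[symmetric]
    by (rule sum.mono_neutral_left) (use that in \<open>auto simp: S_def in_keys_iff\<close>)
  have "Poly_Mapping.keys (F + G) \<subseteq> S"
    unfolding S_def by (rule Poly_Mapping.keys_add)
  then show ?thesis
    by (simp add: * S_def lookup_add distrib_right sum.distrib)
qed

lemma eval_laurent_sum:
  "eval_laurent (\<Sum>x\<in>X. f x) z = (\<Sum>x\<in>X. eval_laurent (f x) z)"
proof (induction X rule: infinite_finite_induct)
  case (insert x X)
  then show ?case by (simp add: eval_laurent_add)
qed (simp_all add: eval_laurent_def)

lemma lookup_mat_exponent:
  "Poly_Mapping.lookup (mat_exponent A e) i =
     (if i < dim_row A then \<Sum>j<dim_col A. A $$ (i, j) * Poly_Mapping.lookup e j else 0)"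
  by (simp add: mat_exponent_def lookup_sum lookup_single when_def sum.delta)

lemma keys_mat_exponent: "Poly_Mapping.keys (mat_exponent A e) \<subseteq> {..<dim_row A}"
  by (auto simp: in_keys_iff lookup_mat_exponent split: if_splits)

lemma laurent_subst_in_laurent_polys: "laurent_subst F A \<in> laurent_polys (dim_row A)"
proof -
  have "Poly_Mapping.keys (laurent_subst F A) \<subseteq>
      (\<Union>e\<in>Poly_Mapping.keys F.
         Poly_Mapping.keys (Poly_Mapping.single (mat_exponent A e) (Poly_Mapping.lookup F e)))"
    unfolding laurent_subst_def by (rule keys_sum)
  also have "\<dots> \<subseteq> mat_exponent A ` Poly_Mapping.keys F"
    by auto
  finally show ?thesis
    using keys_mat_exponent[of A] by (fastforce simp: laurent_polys_def)
qed

lemma powi_sum_exponent: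
  fixes x :: complex
  assumes "x \<noteq> 0"
  shows "x powi (\<Sum>j\<in>J. f j) = (\<Prod>j\<in>J. x powi f j)"
  by (induction J rule: infinite_finite_induct) (use assms in \<open>auto simp: power_int_add\<close>)

lemma powi_prod_base:
  fixes f :: "'b \<Rightarrow> complex"
  shows "(\<Prod>i\<in>I. f i) powi n = (\<Prod>i\<in>I. f i powi n)"
  by (induction I rule: infinite_finite_induct) (auto simp: power_int_mult_distrib)

lemma eval_laurent_subst:
  assumes F: "F \<in> laurent_polys (dim_col A)" and z: "\<And>i. i < dim_row A \<Longrightarrow> z i \<noteq> 0"
  shows "eval_laurent (laurent_subst F A) z =
           eval_laurent F (\<lambda>j. \<Prod>i<dim_row A. z i powi (A $$ (i, j)))"
proof -
  define m where "m z e = (\<Prod>i\<in>Poly_Mapping.keys e. z i powi Poly_Mapping.lookup e i)"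
    for z :: "nat \<Rightarrow> complex" and e :: "nat \<Rightarrow>\<^sub>0 int"
  have m_eq: "m y e = (\<Prod>i<n. y i powi Poly_Mapping.lookup e i)"
    if "Poly_Mapping.keys e \<subseteq> {..<n}" for y e n
    unfolding m_def
    by (rule prod.mono_neutral_left) (use that in \<open>auto simp: in_keys_iff\<close>)
  have single: "eval_laurent (Poly_Mapping.single e c) z = c * m z e" for e c
    by (cases "c = 0") (auto simp: eval_laurent_def m_def)
  have mono: "m z (mat_exponent A e) = m (\<lambda>j. \<Prod>i<dim_row A. z i powi (A $$ (i, j))) e"
    if e: "e \<in> Poly_Mapping.keys F" for e
  proof -
    have "m z (mat_exponent A e) =
        (\<Prod>i<dim_row A. \<Prod>j<dim_col A. z i powi (A $$ (i, j) * Poly_Mapping.lookup e j))"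
      unfolding m_eq[OF keys_mat_exponent]
      by (rule prod.cong) (auto simp: lookup_mat_exponent powi_sum_exponent z)
    also have "\<dots> = (\<Prod>j<dim_col A. (\<Prod>i<dim_row A. z i powi (A $$ (i, j))) powi
        Poly_Mapping.lookup e j)"
      by (subst prod.swap) (simp add: powi_prod_base power_int_mult)
    also have "\<dots> = m (\<lambda>j. \<Prod>i<dim_row A. z i powi (A $$ (i, j))) e"
      by (rule m_eq[symmetric]) (use F e in \<open>auto simp: laurent_polys_def\<close>)
    finally show ?thesis .
  qed
  have "eval_laurent (laurent_subst F A) z =
      (\<Sum>e\<in>Poly_Mapping.keys F. Poly_Mapping.lookup F e * m z (mat_exponent A e))"
    by (simp add: laurent_subst_def eval_laurent_sum single)
  also have "\<dots> = eval_laurent F (\<lambda>j. \<Prod>i<dim_row A. z i powi (A $$ (i, j)))"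
    unfolding eval_laurent_def m_def[symmetric] by (rule sum.cong) (auto simp: mono)
  finally show ?thesis .
qed

lemma mahler_measure_0:
  assumes "G \<in> laurent_polys 0"
  shows "mahler_measure 0 G = ln (cmod (Poly_Mapping.lookup G 0))"
proof -
  have "Poly_Mapping.keys G \<subseteq> {0}"
    using assms by (auto simp: laurent_polys_def)
  then have "eval_laurent G z = (\<Sum>e\<in>{0}. Poly_Mapping.lookup G e *
      (\<Prod>i\<in>Poly_Mapping.keys e. z i powi Poly_Mapping.lookup e i))" for z
    unfolding eval_laurent_def
    by (intro sum.mono_neutral_left) (auto simp: in_keys_iff)
  then show ?thesis
    by (simp add: mahler_measure_def PiM_empty lebesgue_integral_count_space_finite)
qed

end

theory Submission
  imports Defs "HOL-Probability.Infinite_Product_Measure"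
begin

text \<open>
  Let \<open>L\<close> be the set of integer vectors in the real row space of \<open>A\<close>, and let \<open>H\<close> be the matrix
  whose rows are the Hermite basis of \<open>L\<close>. Then \<open>A = C H\<close> with \<open>C\<close> integral, and \<open>H = B A\<close> with \<open>B\<close>
  real, so \<open>B C = 1\<close> because the rows of \<open>H\<close> are independent. Hence the monomial map of \<open>C\<close> is a
  surjective homomorphism of tori. The push-forward of the uniform measure under a surjective
  homomorphism is translation invariant, and by Fubini there is only one translation-invariant
  probability measure on the torus. So \<open>m(F_A) = m((F_H)_C) = m(F_H)\<close>; integrability of
  \<open>log |F_H|\<close> plays no role.
\<close>

section \<open>Uniform measure on the torus\<close>

text \<open>A product measure is determined by its values on boxes, and the preimage of a box under
  a componentwise map is a box. This serves both to carry the unit cube to the torus and to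
  translate the torus one coordinate at a time.\<close>

lemma distr_PiM_componentwise:
  assumes "finite I" "\<And>i. prob_space (M i)" 
    and f [measurable]: "\<And>i. f i \<in> M i \<rightarrow>\<^sub>M N i"
  shows "distr (PiM I M) (PiM I N) (\<lambda>x. \<lambda>i\<in>I. f i (x i)) = PiM I (\<lambda>i. distr (M i) (N i) (f i))"
proof -
  interpret M: product_prob_space M I
    by (rule product_prob_spaceI) (fact assms)
  interpret D: product_prob_space "\<lambda>i. distr (M i) (N i) (f i)" I
    by (rule product_prob_spaceI) (intro prob_space.prob_space_distr assms)
  have [measurable]: "(\<lambda>x. \<lambda>i\<in>I. f i (x i)) \<in> PiM I M \<rightarrow>\<^sub>M PiM I N"
    by measurable
  show ?thesis
  proof (rule D.PiM_eqI)
    show "finite I" by fact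
    show "sets (distr (PiM I M) (PiM I N) (\<lambda>x. \<lambda>i\<in>I. f i (x i))) =
        sets (PiM I (\<lambda>i. distr (M i) (N i) (f i)))"
      by (simp cong: sets_PiM_cong)
  next
    fix A assume A: "\<And>i. i \<in> I \<Longrightarrow> A i \<in> sets (distr (M i) (N i) (f i))"
    have "emeasure (distr (PiM I M) (PiM I N) (\<lambda>x. \<lambda>i\<in>I. f i (x i))) (Pi\<^sub>E I A) =
        emeasure (PiM I M) ((\<lambda>x. \<lambda>i\<in>I. f i (x i)) -` Pi\<^sub>E I A \<inter> space (PiM I M))"
      using A \<open>finite I\<close> by (intro emeasure_distr) auto
    also have "(\<lambda>x. \<lambda>i\<in>I. f i (x i)) -` Pi\<^sub>E I A \<inter> space (PiM I M) =
        (\<Pi>\<^sub>E i\<in>I. f i -` A i \<inter> space (M i))"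
      by (auto simp: space_PiM PiE_iff)
    also have "emeasure (PiM I M) \<dots> = (\<Prod>i\<in>I. emeasure (M i) (f i -` A i \<inter> space (M i)))"
      using A by (intro M.emeasure_PiM \<open>finite I\<close>) (auto intro: measurable_sets[OF f])
    also have "\<dots> = (\<Prod>i\<in>I. emeasure (distr (M i) (N i) (f i)) (A i))"
      using A by (intro prod.cong refl) (simp add: emeasure_distr)
    finally show "emeasure (distr (PiM I M) (PiM I N) (\<lambda>x. \<lambda>i\<in>I. f i (x i))) (Pi\<^sub>E I A) =
        (\<Prod>i\<in>I. emeasure (distr (M i) (N i) (f i)) (A i))" .
  qed
qed

section \<open>The circle: uniform measure and rotations\<close>

abbreviation unit_circle_map :: "real \<Rightarrow> complex" where
  "unit_circle_map t \<equiv> exp (2 * of_real pi * \<i> * of_real t)"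

text \<open>Normalized arc length, kept as a Borel measure on the whole plane; lying on the unit
  circle is then an almost-everywhere property (\<open>AE_circle_measure\<close>).\<close>

definition circle_measure :: "complex measure" where
  "circle_measure = distr (restrict_space lborel {0..1}) borel unit_circle_map"

lemma unit_circle_map_add: "unit_circle_map (s + t) = unit_circle_map s * unit_circle_map t"
  by (simp add: ring_distribs exp_add)

lemma unit_circle_map_add_int: "unit_circle_map (t + of_int n) = unit_circle_map t"
proof -
  have "unit_circle_map (of_int n) = 1"
    by (subst exp_eq_1) (auto intro!: exI[of _ n])
  then show ?thesis by (simp only: unit_circle_map_add mult_1_right)
qed

lemma unit_circle_map_surj:
  assumes "cmod w = 1"
  shows "\<exists>s. w = unit_circle_map s"
proof -
  have "w = exp (\<i> * of_real (Arg w))"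
    using assms Arg_eq[of w] by force
  then have "w = unit_circle_map (Arg w / (2 * pi))"
    by (simp add: field_simps)
  then show ?thesis ..
qed

lemma unit_circle_map_measurable [measurable]: "unit_circle_map \<in> borel_measurable borel"
  by (intro borel_measurable_continuous_onI continuous_intros)

lemma unit_circle_map_measurable' [measurable]:
  "unit_circle_map \<in> borel_measurable (restrict_space lborel {0..1})"
  using unit_circle_map_measurable by (intro measurable_restrict_space1) simp

lemma prob_space_unit_interval: "prob_space (restrict_space lborel {0..1::real})"
  by (rule prob_space_restrict_space) auto

lemma prob_space_circle_measure: "prob_space circle_measure"
  unfolding circle_measure_def
  by (intro prob_space.prob_space_distr prob_space_unit_interval unit_circle_map_measurable')

lemma sets_circle_measure [measurable_cong, simp]: "sets circle_measure = sets borel"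
  by (simp add: circle_measure_def)

lemma space_circle_measure [simp]: "space circle_measure = UNIV"
  by (simp add: circle_measure_def)

lemma AE_circle_measure: "AE z in circle_measure. cmod z = 1"
  unfolding circle_measure_def
  by (subst AE_distr_iff[OF unit_circle_map_measurable']) auto

text \<open>By periodicity \<open>s\<close> may be replaced by its fractional part \<open>u\<close>.
  Cutting the interval at \<open>1 - u\<close>, the left piece moves by \<open>u\<close> onto
  \<open>{u..<1}\<close> and the right piece by \<open>u - 1\<close> onto \<open>{0..<u}\<close>;
  the extra shift by 1 is a period.\<close>

lemma nn_integral_periodic_shift:
  fixes g :: "real \<Rightarrow> ennreal"
  assumes [measurable]: "g \<in> borel_measurable borel"
    and per: "\<And>t n. g (t + of_int n) = g t"
  shows "(\<integral>\<^sup>+t\<in>{0..1}. g (s + t) \<partial>lborel) = (\<integral>\<^sup>+t\<in>{0..1}. g t \<partial>lborel)"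
proof -
  define u where "u = frac s"
  have u: "0 \<le> u" "u < 1" by (auto simp: u_def frac_lt_1)
  have gs: "g (s + t) = g (u + t)" for t
    using per[of "u + t" "\<lfloor>s\<rfloor>"] by (simp add: u_def frac_def algebra_simps)
  \<comment> \<open>The endpoint 1 is a null set and is dropped, so that half-open pieces fit
    together.\<close>
  have half: "(\<integral>\<^sup>+t\<in>{0..1}. h t \<partial>lborel) = (\<integral>\<^sup>+t\<in>{0..<a}. h t \<partial>lborel) + (\<integral>\<^sup>+t\<in>{a..<1}. h t \<partial>lborel)"
    if [measurable]: "h \<in> borel_measurable borel" and a: "0 \<le> a" "a \<le> 1" for a :: real and h :: "real \<Rightarrow> ennreal"
  proof -
    have "(\<integral>\<^sup>+t\<in>{0..1}. h t \<partial>lborel) =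
        (\<integral>\<^sup>+t. h t * indicator {0..<a} t + h t * indicator {a..<1} t \<partial>lborel)"
      by (rule nn_integral_cong_AE, rule eventually_mono[OF AE_lborel_singleton[of 1]])
        (use a in \<open>auto simp: indicator_def\<close>)
    also have "\<dots> = (\<integral>\<^sup>+t\<in>{0..<a}. h t \<partial>lborel) + (\<integral>\<^sup>+t\<in>{a..<1}. h t \<partial>lborel)"
      by (rule nn_integral_add) measurable
    finally show ?thesis .
  qed
  have "(\<integral>\<^sup>+t\<in>{0..1}. g (s + t) \<partial>lborel) =
     (\<integral>\<^sup>+t\<in>{0..<1-u}. g (u + t) \<partial>lborel) + (\<integral>\<^sup>+t\<in>{1-u..<1}. g (u + t) \<partial>lborel)"
    unfolding gs using u by (intro half) auto
  also have "(\<integral>\<^sup>+t\<in>{0..<1-u}. g (u + t) \<partial>lborel) = (\<integral>\<^sup>+t\<in>{u..<1}. g t \<partial>lborel)"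
    by (subst (2) nn_integral_real_affine[where c=1 and t=u])
      (auto intro!: nn_integral_cong simp: indicator_def)
  also have "(\<integral>\<^sup>+t\<in>{1-u..<1}. g (u + t) \<partial>lborel) = (\<integral>\<^sup>+t\<in>{0..<u}. g t \<partial>lborel)"
  proof -
    have "g (u - 1 + t) = g (u + t)" for t
      using per[of "u - 1 + t" 1] by (simp add: algebra_simps)
    then show ?thesis
      by (subst (2) nn_integral_real_affine[where c=1 and t="u - 1"])
        (auto intro!: nn_integral_cong simp: indicator_def)
  qed
  also have "(\<integral>\<^sup>+t\<in>{u..<1}. g t \<partial>lborel) + (\<integral>\<^sup>+t\<in>{0..<u}. g t \<partial>lborel) = (\<integral>\<^sup>+t\<in>{0..1}. g t \<partial>lborel)"
    using half[of g u] u by (simp add: add.commute)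
  finally show ?thesis .
qed

text \<open>Writing \<open>w\<close> as \<open>unit_circle_map s\<close> turns the rotation into a
  shift of the parameter by \<open>s\<close>, and the indicator of a set composed with
  \<open>unit_circle_map\<close> has period 1.\<close>

lemma circle_measure_mult:
  assumes "cmod w = 1"
  shows "distr circle_measure borel ((*) w) = circle_measure"
proof -
  obtain s where w: "w = unit_circle_map s"
    using unit_circle_map_surj[OF assms] by blast
  show ?thesis
  proof (rule measure_eqI)
    fix A assume "A \<in> sets (distr circle_measure borel ((*) w))"
    then have [measurable]: "A \<in> sets borel" by simp
    have em: "emeasure (distr (restrict_space lborel {0..1::real}) borel h) A =
        (\<integral>\<^sup>+t\<in>{0..1}. indicator A (h t) \<partial>lborel)" 
      if [measurable]: "h \<in> borel_measurable borel" for h :: "real \<Rightarrow> complex"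
    proof -
      have [measurable]: "h \<in> borel_measurable (restrict_space lborel {0..1})"
        by (rule measurable_restrict_space1) simp
      have "emeasure (distr (restrict_space lborel {0..1::real}) borel h) A =
         (\<integral>\<^sup>+z. indicator A z \<partial>(distr (restrict_space lborel {0..1::real}) borel h))"
        by simp
      also have "\<dots> = (\<integral>\<^sup>+t. indicator A (h t) \<partial>restrict_space lborel {0..1::real})"
        by (subst nn_integral_distr) auto
      also have "\<dots> = (\<integral>\<^sup>+t\<in>{0..1}. indicator A (h t) \<partial>lborel)"
        by (subst nn_integral_restrict_space) auto
      finally show ?thesis .
    qed
    have "distr circle_measure borel ((*) w) =
        distr (restrict_space lborel {0..1}) borel (\<lambda>t. unit_circle_map (s + t))"
      unfolding circle_measure_def w unit_circle_map_add
      by (subst distr_distr) (auto simp: o_def intro!: measurable_restrict_space1)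
    moreover have "(\<integral>\<^sup>+t\<in>{0..1}. indicator A (unit_circle_map (s + t)) \<partial>lborel) = 
        (\<integral>\<^sup>+t\<in>{0..1}. indicator A (unit_circle_map t) \<partial>lborel)"
      by (rule nn_integral_periodic_shift) (measurable, simp only: unit_circle_map_add_int)
    ultimately show "emeasure (distr circle_measure borel ((*) w)) A = emeasure circle_measure A"
      by (simp only: circle_measure_def em unit_circle_map_measurable)
        (subst em; measurable)
  qed simp
qed

text \<open>Integrate the indicator of \<open>A\<close> at \<open>m u x\<close> over both variables:
  doing \<open>u\<close> first gives the mass of \<open>A\<close> under \<nu>, doing
  \<open>x\<close> first gives its mass under \<mu>, and Fubini equates the two. Invariance is
  stated almost everywhere because the torus measures live on all complex tuples, while translation
  is controlled for tuples with entries of modulus 1.\<close>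

lemma prob_measures_eq_if_translation_invariant:
  assumes "prob_space \<mu>" "prob_space \<nu>" and sets: "sets \<mu> = sets \<nu>"
    and m [measurable]: "case_prod m \<in> \<nu> \<Otimes>\<^sub>M \<nu> \<rightarrow>\<^sub>M \<nu>"
    and \<nu>: "AE x in \<mu>. distr \<nu> \<nu> (\<lambda>u. m u x) = \<nu>"
    and \<mu>: "AE u in \<nu>. distr \<mu> \<mu> (\<lambda>x. m u x) = \<mu>"
  shows "\<mu> = \<nu>"
proof (rule measure_eqI)
  interpret \<mu>: prob_space \<mu> by fact
  interpret \<nu>: prob_space \<nu> by fact
  interpret P: pair_sigma_finite \<nu> \<mu> ..
  note [measurable_cong] = sets
  have sp: "space \<mu> = space \<nu>" using sets by (rule sets_eq_imp_space_eq)
  fix A assume "A \<in> sets \<mu>"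
  then have [measurable]: "A \<in> sets \<nu>" "A \<in> sets \<mu>" by (auto simp: sets)
  have 1: "AE x in \<mu>. (\<integral>\<^sup>+u. indicator A (m u x) \<partial>\<nu>) = emeasure \<nu> A"
    using \<nu> AE_space
  proof eventually_elim
    case (elim x)
    then have [measurable]: "(\<lambda>u. m u x) \<in> \<nu> \<rightarrow>\<^sub>M \<nu>"
      using measurable_compose[OF measurable_Pair[OF measurable_ident measurable_const[of x]] m]
      by (simp add: sp)
    have "(\<integral>\<^sup>+u. indicator A (m u x) \<partial>\<nu>) = (\<integral>\<^sup>+u. indicator A u \<partial>distr \<nu> \<nu> (\<lambda>u. m u x))"
      by (subst nn_integral_distr) auto
    then show ?case using elim by simp
  qed
  have 2: "AE u in \<nu>. (\<integral>\<^sup>+x. indicator A (m u x) \<partial>\<mu>) = emeasure \<mu> A"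
    using \<mu> AE_space
  proof eventually_elim
    case (elim u)
    then have "(\<lambda>x. m u x) \<in> \<nu> \<rightarrow>\<^sub>M \<nu>"
      using measurable_compose[OF measurable_Pair[OF measurable_const[of u] measurable_ident] m]
      by simp
    then have [measurable]: "(\<lambda>x. m u x) \<in> \<mu> \<rightarrow>\<^sub>M \<mu>"
      by (simp cong: measurable_cong_sets add: sets)
    have "(\<integral>\<^sup>+x. indicator A (m u x) \<partial>\<mu>) = (\<integral>\<^sup>+x. indicator A x \<partial>distr \<mu> \<mu> (\<lambda>x. m u x))"
      by (subst nn_integral_distr) auto
    then show ?case using elim by simp
  qed
  have "emeasure \<nu> A = (\<integral>\<^sup>+x. emeasure \<nu> A \<partial>\<mu>)"
    by (simp add: \<mu>.emeasure_space_1)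
  also have "\<dots> = (\<integral>\<^sup>+x. (\<integral>\<^sup>+u. indicator A (m u x) \<partial>\<nu>) \<partial>\<mu>)"
    by (rule nn_integral_cong_AE) (use 1 in \<open>auto elim: eventually_mono\<close>)
  also have "\<dots> = (\<integral>\<^sup>+u. (\<integral>\<^sup>+x. indicator A (m u x) \<partial>\<mu>) \<partial>\<nu>)"
    by (rule P.Fubini') measurable
  also have "\<dots> = (\<integral>\<^sup>+u. emeasure \<mu> A \<partial>\<nu>)"
    by (rule nn_integral_cong_AE) (rule 2)
  also have "\<dots> = emeasure \<mu> A"
    by (simp add: \<nu>.emeasure_space_1)
  finally show "emeasure \<mu> A = emeasure \<nu> A" ..
qed fact

section \<open>The torus and its translations\<close>

definition torus_measure :: "nat \<Rightarrow> (nat \<Rightarrow> complex) measure" where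
  "torus_measure l = (\<Pi>\<^sub>M i\<in>{..<l}. circle_measure)"

lemma sets_torus_measure [measurable_cong]:
  "sets (torus_measure l) = sets (\<Pi>\<^sub>M i\<in>{..<l}. borel)"
  unfolding torus_measure_def by (rule sets_PiM_cong) auto

lemma prob_space_torus_measure: "prob_space (torus_measure l)"
  unfolding torus_measure_def by (intro prob_space_PiM prob_space_circle_measure)

lemma AE_torus_measure: "AE z in torus_measure l. \<forall>i<l. cmod (z i) = 1"
proof -
  have "AE z in torus_measure l. \<forall>i\<in>{..<l}. cmod (z i) = 1"
    unfolding torus_measure_def
    by (intro AE_finite_allI AE_PiM_component prob_space_circle_measure AE_circle_measure) auto
  then show ?thesis by (simp add: Ball_def)
qed

text \<open>The restriction returns \<open>undefined\<close> outside \<open>{..<l}\<close>, as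
  membership in the space of the product measure demands.\<close>

definition torus_mult :: "nat \<Rightarrow> (nat \<Rightarrow> complex) \<Rightarrow> (nat \<Rightarrow> complex) \<Rightarrow> nat \<Rightarrow> complex" where
  "torus_mult l w z = (\<lambda>i\<in>{..<l}. w i * z i)"

lemma torus_mult_commute: "torus_mult l w z = torus_mult l z w"
  by (simp add: torus_mult_def mult.commute)

lemma torus_mult_measurable_pair [measurable]:
  "case_prod (torus_mult l) \<in> torus_measure l \<Otimes>\<^sub>M torus_measure l \<rightarrow>\<^sub>M torus_measure l"
  unfolding torus_mult_def by measurable

lemma torus_mult_measurable [measurable]:
  "torus_mult l w \<in> torus_measure l \<rightarrow>\<^sub>M torus_measure l"
  unfolding torus_mult_def by measurable

lemma torus_measure_translate:
  assumes w: "\<forall>i<l. cmod (w i) = 1"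
  shows "distr (torus_measure l) (torus_measure l) (torus_mult l w) = torus_measure l"
proof -
  \<comment> \<open>Padding with 1 makes every factor a rotation, so the families of rotated and
    original circle measures agree at all indices.\<close>
  define w' where "w' i = (if i < l then w i else 1)" for i
  have "distr (torus_measure l) (torus_measure l) (torus_mult l w) =
      distr (\<Pi>\<^sub>M i\<in>{..<l}. circle_measure) (\<Pi>\<^sub>M i\<in>{..<l}. circle_measure) (\<lambda>z. \<lambda>i\<in>{..<l}. w' i * z i)"
    unfolding torus_measure_def 
    by (intro distr_cong) (auto simp: torus_mult_def w'_def fun_eq_iff restrict_def)
  also have "\<dots> = (\<Pi>\<^sub>M i\<in>{..<l}. distr circle_measure circle_measure ((*) (w' i)))"
    by (rule distr_PiM_componentwise) (auto simp: prob_space_circle_measure)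
  also have "(\<lambda>i. distr circle_measure circle_measure ((*) (w' i))) = (\<lambda>i. circle_measure)"
  proof
    fix i
    have "distr circle_measure circle_measure ((*) (w' i)) = distr circle_measure borel ((*) (w' i))"
      by (rule distr_cong) auto
    also have "\<dots> = circle_measure"
      by (rule circle_measure_mult) (use w in \<open>auto simp: w'_def\<close>)
    finally show "distr circle_measure circle_measure ((*) (w' i)) = circle_measure" .
  qed
  finally show ?thesis by (simp add: torus_measure_def)
qed

section \<open>Monomial maps as homomorphisms of tori\<close>

definition monomial_map :: "int mat \<Rightarrow> (nat \<Rightarrow> complex) \<Rightarrow> nat \<Rightarrow> complex" where
  "monomial_map C z = (\<lambda>j\<in>{..<dim_col C}. \<Prod>i<dim_row C. z i powi (C $$ (i, j)))"

lemma powi_measurable [measurable (raw)]: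
  fixes f :: "'a \<Rightarrow> complex"
  assumes [measurable]: "f \<in> borel_measurable M"
  shows "(\<lambda>x. f x powi n) \<in> borel_measurable M"
  unfolding power_int_def by measurable

lemma monomial_map_measurable:
  assumes "C \<in> carrier_mat l n"
  shows "monomial_map C \<in> torus_measure l \<rightarrow>\<^sub>M torus_measure n"
proof -
  have [simp]: "dim_row C = l" "dim_col C = n" using assms by auto
  have "(\<lambda>z. \<lambda>j\<in>{..<n}. \<Prod>i<l. z i powi (C $$ (i, j))) \<in>
      torus_measure l \<rightarrow>\<^sub>M (\<Pi>\<^sub>M j\<in>{..<n}. borel)"
  proof (rule measurable_restrict)
    fix j
    have "(\<lambda>z. z i) \<in> borel_measurable (torus_measure l)" if "i \<in> {..<l}" for i
      using that by measurable
    then show "(\<lambda>z. \<Prod>i<l. z i powi (C $$ (i, j))) \<in> borel_measurable (torus_measure l)"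
      by (intro borel_measurable_prod powi_measurable)
  qed
  then show ?thesis
    by (simp add: monomial_map_def[abs_def] cong: measurable_cong_sets add: sets_torus_measure)
qed

lemma monomial_map_mult:
  assumes "C \<in> carrier_mat l n"
  shows "monomial_map C (torus_mult l v z) = torus_mult n (monomial_map C v) (monomial_map C z)"
  using assms
  by (auto simp: monomial_map_def torus_mult_def fun_eq_iff restrict_def power_int_mult_distrib
      prod.distrib)

lemma torus_mult_cong:
  "(\<And>i. i < l \<Longrightarrow> w i = w' i) \<Longrightarrow> torus_mult l w z = torus_mult l w' z"
  by (auto simp: torus_mult_def fun_eq_iff)

lemma cmod_monomial_map:
  assumes "C \<in> carrier_mat l n" "\<forall>i<l. cmod (z i) = 1" "j < n"
  shows "cmod (monomial_map C z j) = 1"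
  using assms by (auto simp: monomial_map_def norm_power_int prod_norm[symmetric] intro!: prod.neutral)

text \<open>To translate the image measure by \<open>u\<close>, lift \<open>u\<close> to a point
  \<open>v\<close> of the source torus; since the map is a homomorphism, the translation becomes one
  by \<open>v\<close> upstairs, where the measure is invariant. Uniqueness of the invariant
  probability measure then applies. Surjectivity is only required on coordinates
  \<open>j < n\<close>, since \<open>w\<close> is arbitrary elsewhere.\<close>

lemma distr_monomial_map:
  assumes C: "C \<in> carrier_mat l n"
    and surj: "\<And>w. \<forall>j<n. cmod (w j) = 1 \<Longrightarrow>
      \<exists>v. (\<forall>i<l. cmod (v i) = 1) \<and> (\<forall>j<n. w j = monomial_map C v j)"
  shows "distr (torus_measure l) (torus_measure n) (monomial_map C) = torus_measure n"
proof (rule prob_measures_eq_if_translation_invariant[where m = "torus_mult n"])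
  note [measurable] = monomial_map_measurable[OF C]
  let ?\<mu> = "distr (torus_measure l) (torus_measure n) (monomial_map C)"
  show "prob_space ?\<mu>"
    by (intro prob_space.prob_space_distr prob_space_torus_measure) measurable
  show "prob_space (torus_measure n)"
    by (rule prob_space_torus_measure)
  \<comment> \<open>The image measure is concentrated on the torus, so the uniform measure is
    invariant under almost all of its points.\<close>
  have "AE z in torus_measure l. \<forall>j<n. cmod (monomial_map C z j) = 1"
    using AE_torus_measure by eventually_elim (simp add: cmod_monomial_map[OF C])
  then have "AE x in ?\<mu>. \<forall>j<n. cmod (x j) = 1"
    by (subst AE_distr_iff) measurable
  then show "AE x in ?\<mu>. distr (torus_measure n) (torus_measure n) (\<lambda>u. torus_mult n u x) = torus_measure n"
  proof eventually_elim
    case (elim x)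
    then show ?case
      by (simp add: torus_measure_translate torus_mult_commute[of n _ x])
  qed
  show "AE u in torus_measure n. distr ?\<mu> ?\<mu> (torus_mult n u) = ?\<mu>"
    using AE_torus_measure
  proof eventually_elim
    case (elim u)
    then obtain v where v: "\<forall>i<l. cmod (v i) = 1" "\<forall>j<n. u j = monomial_map C v j"
      using surj by blast
    have eq: "torus_mult n u (monomial_map C z) = monomial_map C (torus_mult l v z)" for z
      unfolding monomial_map_mult[OF C] by (rule torus_mult_cong) (use v in auto)
    have "distr ?\<mu> ?\<mu> (torus_mult n u) = distr ?\<mu> (torus_measure n) (torus_mult n u)"
      by (rule distr_cong) auto
    also have "\<dots> = distr (torus_measure l) (torus_measure n) (monomial_map C \<circ> torus_mult l v)"
      by (simp add: distr_distr eq o_def)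
    also have "\<dots> = distr (distr (torus_measure l) (torus_measure l) (torus_mult l v)) (torus_measure n) (monomial_map C)"
      by (rule distr_distr[symmetric]) measurable
    finally show ?case
      by (simp only: torus_measure_translate[OF v(1)])
  qed
  show "case_prod (torus_mult n) \<in> torus_measure n \<Otimes>\<^sub>M torus_measure n \<rightarrow>\<^sub>M torus_measure n"
    by (rule torus_mult_measurable_pair)
qed (rule sets_distr)

lemma unit_circle_map_powi: "unit_circle_map t powi n = unit_circle_map (t * of_int n)"
  by (simp add: exp_power_int mult_ac)

lemma unit_circle_map_sum:
  assumes "finite I"
  shows "unit_circle_map (\<Sum>i\<in>I. f i) = (\<Prod>i\<in>I. unit_circle_map (f i))"
  using assms by (simp add: exp_sum[symmetric] sum_distrib_left)

text \<open>In angle coordinates the map is the linear map sending a row \<open>x\<close> to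
  \<open>x C\<close>. A real left inverse \<open>B\<close> of \<open>C\<close> solves
  \<open>x C = \<theta>\<close> by \<open>x = \<theta> B\<close>; real entries suffice because
  angles, unlike points of the circle, can be multiplied by reals.\<close>

lemma monomial_map_surj:
  assumes C: "C \<in> carrier_mat l n"
    and B: "\<And>s r. s < n \<Longrightarrow> r < n \<Longrightarrow>
      (\<Sum>i<l. B s i * real_of_int (C $$ (i, r))) = (if r = s then 1 else 0)"
    and w: "\<forall>j<n. cmod (w j) = 1"
  shows "\<exists>v. (\<forall>i<l. cmod (v i) = 1) \<and> (\<forall>j<n. w j = monomial_map C v j)"
proof -
  \<comment> \<open>Some choice of angles for the target point \<open>w\<close>; any lift to the
    reals will do.\<close>
  define \<theta> where "\<theta> j = (SOME s. w j = unit_circle_map s)" for j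
  have \<theta>: "w j = unit_circle_map (\<theta> j)" if "j < n" for j
    unfolding \<theta>_def by (rule someI_ex, rule unit_circle_map_surj) (use w that in simp)
  define x where "x i = (\<Sum>s<n. \<theta> s * B s i)" for i
  have "w j = monomial_map C (\<lambda>i. unit_circle_map (x i)) j" if j: "j < n" for j
  proof -
    have "(\<Sum>i<l. x i * real_of_int (C $$ (i, j))) =
        (\<Sum>s<n. \<theta> s * (\<Sum>i<l. B s i * real_of_int (C $$ (i, j))))"
      unfolding x_def sum_distrib_left sum_distrib_right
      by (subst sum.swap) (simp add: mult.assoc)
    also have "\<dots> = (\<Sum>s<n. if s = j then \<theta> j else 0)"
      by (rule sum.cong) (use B j in auto)
    also have "\<dots> = \<theta> j" using j by simp
    finally have *: "(\<Sum>i<l. x i * real_of_int (C $$ (i, j))) = \<theta> j" .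
    have "monomial_map C (\<lambda>i. unit_circle_map (x i)) j =
        (\<Prod>i<l. unit_circle_map (x i * real_of_int (C $$ (i, j))))"
      using C j by (simp add: monomial_map_def unit_circle_map_powi)
    also have "\<dots> = unit_circle_map (\<theta> j)"
      by (simp only: unit_circle_map_sum[symmetric] finite_lessThan *)
    finally show ?thesis using \<theta>[OF j] by simp
  qed
  moreover have "\<forall>i<l. cmod (unit_circle_map (x i)) = 1" by simp
  ultimately show ?thesis
    by (intro exI[of _ "\<lambda>i. unit_circle_map (x i)"]) simp
qed

section \<open>Mahler measure under substitution\<close>

lemma eval_laurent_cong:
  assumes "G \<in> laurent_polys l" "\<And>i. i < l \<Longrightarrow> z i = z' i"
  shows "eval_laurent G z = eval_laurent G z'"
proof -
  have "(\<Prod>i\<in>Poly_Mapping.keys e. z i powi Poly_Mapping.lookup e i) =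
      (\<Prod>i\<in>Poly_Mapping.keys e. z' i powi Poly_Mapping.lookup e i)"
    if "e \<in> Poly_Mapping.keys G" for e
  proof (rule prod.cong)
    fix i assume "i \<in> Poly_Mapping.keys e"
    then have "i < l" using assms(1) that by (auto simp: laurent_polys_def)
    then show "z i powi Poly_Mapping.lookup e i = z' i powi Poly_Mapping.lookup e i"
      by (simp add: assms(2))
  qed simp
  then show ?thesis
    unfolding eval_laurent_def by (intro sum.cong) simp_all
qed

lemma eval_laurent_measurable:
  assumes "G \<in> laurent_polys l"
  shows "eval_laurent G \<in> borel_measurable (torus_measure l)"
proof -
  have "(\<lambda>z. z i) \<in> borel_measurable (torus_measure l)"
    if "e \<in> Poly_Mapping.keys G" "i \<in> Poly_Mapping.keys e" for e i
  proof -
    have "i \<in> {..<l}" using that assms by (auto simp: laurent_polys_def)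
    then show ?thesis by measurable
  qed
  then have "(\<lambda>z. \<Prod>i\<in>Poly_Mapping.keys e. z i powi Poly_Mapping.lookup e i) \<in>
      borel_measurable (torus_measure l)" if "e \<in> Poly_Mapping.keys G" for e
    using that by (intro borel_measurable_prod powi_measurable)
  then show ?thesis
    unfolding eval_laurent_def
    by (intro borel_measurable_sum borel_measurable_times borel_measurable_const)
qed

text \<open>Changes variables from the cube of the definition to the torus, where invariance is
  available.\<close>

lemma mahler_measure_torus:
  assumes G: "G \<in> laurent_polys l"
  shows "mahler_measure l G = (\<integral>z. ln (cmod (eval_laurent G z)) \<partial>torus_measure l)"
proof -
  note [measurable] = eval_laurent_measurable[OF G]
  let ?I = "\<Pi>\<^sub>M i\<in>{..<l}. restrict_space lborel {0..1::real}"
  let ?e = "\<lambda>t. \<lambda>i\<in>{..<l}. unit_circle_map (t i)"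
  have "torus_measure l = distr ?I (\<Pi>\<^sub>M i\<in>{..<l}. borel) ?e"
    unfolding torus_measure_def circle_measure_def
    by (rule distr_PiM_componentwise[symmetric]) (auto simp: prob_space_unit_interval)
  also have "\<dots> = distr ?I (torus_measure l) ?e"
    by (rule distr_cong) (auto simp: sets_torus_measure)
  finally have "(\<integral>z. ln (cmod (eval_laurent G z)) \<partial>torus_measure l) =
      (\<integral>z. ln (cmod (eval_laurent G z)) \<partial>distr ?I (torus_measure l) ?e)" by simp
  also have "\<dots> = (\<integral>t. ln (cmod (eval_laurent G (?e t))) \<partial>?I)"
    by (rule integral_distr) measurable
  also have "\<dots> = mahler_measure l G"
    unfolding mahler_measure_def
    \<comment> \<open>The restricted point differs from the one in the definition only at indices
      from \<open>l\<close> on, which \<open>G\<close> does not see.\<close>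
    by (intro Bochner_Integration.integral_cong refl arg_cong[where f = "\<lambda>x. ln (cmod x)"] eval_laurent_cong[OF G]) simp
  finally show ?thesis ..
qed

lemma mahler_measure_subst_surj:
  assumes C: "C \<in> carrier_mat l n" and G: "G \<in> laurent_polys n"
    and surj: "\<And>w. \<forall>j<n. cmod (w j) = 1 \<Longrightarrow>
      \<exists>v. (\<forall>i<l. cmod (v i) = 1) \<and> (\<forall>j<n. w j = monomial_map C v j)"
  shows "mahler_measure l (laurent_subst G C) = mahler_measure n G"
proof -
  note [measurable] = eval_laurent_measurable[OF G] monomial_map_measurable[OF C]
  have GC: "laurent_subst G C \<in> laurent_polys l"
    using laurent_subst_in_laurent_polys[of G C] C by simp
  note [measurable] = eval_laurent_measurable[OF GC]
  have "mahler_measure n G =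
      (\<integral>z. ln (cmod (eval_laurent G z)) \<partial>distr (torus_measure l) (torus_measure n) (monomial_map C))"
    by (simp only: mahler_measure_torus[OF G] distr_monomial_map[OF C surj])
  also have "\<dots> = (\<integral>z. ln (cmod (eval_laurent G (monomial_map C z))) \<partial>torus_measure l)"
    by (rule integral_distr) measurable
  also have "\<dots> = (\<integral>z. ln (cmod (eval_laurent (laurent_subst G C) z)) \<partial>torus_measure l)"
  proof (rule integral_cong_AE)
    \<comment> \<open>Evaluation commutes with substitution at points with nonzero coordinates,
      hence almost everywhere.\<close>
    show "AE z in torus_measure l. ln (cmod (eval_laurent G (monomial_map C z))) =
        ln (cmod (eval_laurent (laurent_subst G C) z))"
      using AE_torus_measure
    proof eventually_elim
      case (elim z)
      have "eval_laurent (laurent_subst G C) z =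
          eval_laurent G (\<lambda>j. \<Prod>i<dim_row C. z i powi (C $$ (i, j)))"
        by (rule eval_laurent_subst) (use C G elim in auto)
      also have "\<dots> = eval_laurent G (monomial_map C z)"
        by (rule eval_laurent_cong[OF G]) (use C in \<open>auto simp: monomial_map_def\<close>)
      finally show ?case by simp
    qed
  qed measurable
  finally show ?thesis by (simp add: mahler_measure_torus[OF GC])
qed

section \<open>Algebra of monomial substitutions\<close>

lemma laurent_subst_superset:
  assumes "finite S" "Poly_Mapping.keys F \<subseteq> S"
  shows "laurent_subst F A =
    (\<Sum>e\<in>S. Poly_Mapping.single (mat_exponent A e) (Poly_Mapping.lookup F e))"
  unfolding laurent_subst_def
  by (rule sum.mono_neutral_left) (use assms in \<open>auto simp: in_keys_iff\<close>)

lemma laurent_subst_0 [simp]: "laurent_subst 0 A = 0"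
  by (simp add: laurent_subst_def)

text \<open>Coefficients may cancel in \<open>F + G\<close>, so all three sums are first extended to
  the union of the supports.\<close>

lemma laurent_subst_add: "laurent_subst (F + G) A = laurent_subst F A + laurent_subst G A"
proof -
  let ?S = "Poly_Mapping.keys F \<union> Poly_Mapping.keys G"
  have *: "laurent_subst X A =
      (\<Sum>e\<in>?S. Poly_Mapping.single (mat_exponent A e) (Poly_Mapping.lookup X e))"
    if "Poly_Mapping.keys X \<subseteq> ?S" for X
    by (rule laurent_subst_superset) (use that in auto)
  show ?thesis
    by (simp add: * keys_add lookup_add single_add sum.distrib)
qed

lemma laurent_subst_sum: "laurent_subst (\<Sum>x\<in>X. f x) A = (\<Sum>x\<in>X. laurent_subst (f x) A)"
  by (induction X rule: infinite_finite_induct) (simp_all add: laurent_subst_add)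

lemma laurent_subst_single:
  "laurent_subst (Poly_Mapping.single e c) A = Poly_Mapping.single (mat_exponent A e) c"
  by (cases "c = 0") (simp_all add: laurent_subst_def)

lemma mat_exponent_mult:
  assumes "dim_col C = dim_row H"
  shows "mat_exponent (C * H) e = mat_exponent C (mat_exponent H e)"
proof (rule poly_mapping_eqI)
  fix i
  show "Poly_Mapping.lookup (mat_exponent (C * H) e) i =
      Poly_Mapping.lookup (mat_exponent C (mat_exponent H e)) i"
  proof (cases "i < dim_row C")
    case True
    have "(\<Sum>j<dim_col H. (C * H) $$ (i, j) * Poly_Mapping.lookup e j) =
        (\<Sum>j<dim_col H. \<Sum>r<dim_row H. C $$ (i, r) * (H $$ (r, j) * Poly_Mapping.lookup e j))"
      using True assms
      by (intro sum.cong) (auto simp: scalar_prod_def atLeast0LessThan sum_distrib_right mult.assoc)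
    also have "\<dots> = (\<Sum>r<dim_row H. C $$ (i, r) * (\<Sum>j<dim_col H. H $$ (r, j) * Poly_Mapping.lookup e j))"
      by (subst sum.swap) (simp add: sum_distrib_left)
    finally show ?thesis using True assms by (simp add: lookup_mat_exponent)
  qed (simp add: lookup_mat_exponent)
qed

text \<open>On single monomials this is associativity of matrix action, and additivity does the
  rest. It exhibits \<open>F_A\<close> as a substitution into \<open>F_H\<close> whenever
  \<open>A = C * H\<close>.\<close>

lemma laurent_subst_mult:
  assumes "dim_col C = dim_row H"
  shows "laurent_subst F (C * H) = laurent_subst (laurent_subst F H) C"
  unfolding laurent_subst_def[of F]
  by (simp add: laurent_subst_sum laurent_subst_single mat_exponent_mult[OF assms])

section \<open>Hermite bases of subgroups and saturation\<close>

text \<open>Row \<open>i < n\<close> has its pivot in column \<open>p i\<close>; only the entries \<open>h i j\<close> with \<open>j < k\<close> matter.\<close>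

definition hnf_rows :: "nat \<Rightarrow> nat \<Rightarrow> (nat \<Rightarrow> nat) \<Rightarrow> (nat \<Rightarrow> nat \<Rightarrow> int) \<Rightarrow> bool" where
  "hnf_rows k n p h \<longleftrightarrow>
     (\<forall>i<n. p i < k \<and> h i (p i) > 0 \<and> (\<forall>j<p i. h i j = 0) \<and>
        (\<forall>i'<i. p i' < p i \<and> 0 \<le> h i' (p i) \<and> h i' (p i) < h i (p i)))"

text \<open>Reduce \<open>v\<close> at the pivots from left to right by division with remainder. Row
  \<open>m\<close> vanishes in the earlier pivot columns, so residues already obtained there
  survive.\<close>

lemma hnf_rows_reduce:
  assumes "hnf_rows k n p h"
  shows "\<exists>c. \<forall>i<n. 0 \<le> v (p i) + (\<Sum>r<n. c r * h r (p i)) \<and>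
    v (p i) + (\<Sum>r<n. c r * h r (p i)) < h i (p i)"
proof -
  have "\<exists>c. \<forall>i<m. 0 \<le> v (p i) + (\<Sum>r<m. c r * h r (p i)) \<and>
      v (p i) + (\<Sum>r<m. c r * h r (p i)) < h i (p i)" if "m \<le> n" for m
    using that
  proof (induction m)
    case (Suc m)
    then obtain c where c: "\<forall>i<m. 0 \<le> v (p i) + (\<Sum>r<m. c r * h r (p i)) \<and>
      v (p i) + (\<Sum>r<m. c r * h r (p i)) < h i (p i)" by auto
    define w where "w = v (p m) + (\<Sum>r<m. c r * h r (p m))"
    define c' where "c' = c(m := - (w div h m (p m)))"
    have pos: "h m (p m) > 0" and z: "\<And>i. i < m \<Longrightarrow> h m (p i) = 0"
      using assms Suc.prems by (auto simp: hnf_rows_def)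
    have sum: "(\<Sum>r<Suc m. c' r * h r j) = (\<Sum>r<m. c r * h r j) - w div h m (p m) * h m j" for j
      by (simp add: c'_def)
    have "0 \<le> v (p i) + (\<Sum>r<Suc m. c' r * h r (p i)) \<and>
        v (p i) + (\<Sum>r<Suc m. c' r * h r (p i)) < h i (p i)" if "i < Suc m" for i
    proof (cases "i = m")
      case True
      have "v (p m) + (\<Sum>r<Suc m. c' r * h r (p m)) = w mod h m (p m)"
        unfolding sum by (simp add: w_def minus_div_mult_eq_mod[symmetric])
      then show ?thesis using True pos by simp
    next
      case False
      then show ?thesis unfolding sum using that c z by simp
    qed
    then show ?case by blast
  qed simp
  then show ?thesis by blast
qed

text \<open>Read off column \<open>p i\<close>: earlier rows have coefficient 0 by induction and
  later rows vanish there, so only the pivot term remains.\<close>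

lemma hnf_rows_independent:
  fixes x :: "nat \<Rightarrow> real"
  assumes h: "hnf_rows k n p h"
    and x: "\<forall>j<k. (\<Sum>i<n. x i * of_int (h i j)) = 0"
  shows "i < n \<Longrightarrow> x i = 0"
proof (induction i rule: less_induct)
  case (less i)
  have "x r * of_int (h r (p i)) = 0" if "r < n" "r \<noteq> i" for r
  proof (cases "r < i")
    case True
    then show ?thesis using less that by simp
  next
    case False
    then have "p i < p r" using h that by (auto simp: hnf_rows_def)
    then show ?thesis using h that by (simp add: hnf_rows_def)
  qed
  then have "(\<Sum>r<n. x r * of_int (h r (p i))) = (\<Sum>r\<in>{i}. x r * of_int (h r (p i)))"
    using less.prems by (intro sum.mono_neutral_right) auto
  moreover have "p i < k" "h i (p i) > 0"
    using h less.prems by (auto simp: hnf_rows_def)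
  ultimately show ?case using x by simp
qed

text \<open>The pivots inject the rows into the columns.\<close>

lemma hnf_rows_imp_le:
  assumes "hnf_rows k n p h"
  shows "n \<le> k"
proof -
  have "inj_on p {..<n}"
    using assms by (intro linorder_inj_onI) (auto simp: hnf_rows_def, fastforce)
  then have "card {..<n} \<le> card {..<k}"
    using assms by (intro card_inj_on_le[of p]) (auto simp: hnf_rows_def)
  then show ?thesis by simp
qed

text \<open>
  Downward induction on the first column in which an element of \<open>L\<close> may be nonzero: a vector whose
  entry in the new column is minimal positive becomes the new top row.
\<close>

lemma hnf_basis_of_subgroup:
  fixes L :: "(nat \<Rightarrow> int) set"
  assumes add: "\<And>v w a. v \<in> L \<Longrightarrow> w \<in> L \<Longrightarrow> (\<lambda>j. v j + a * w j) \<in> L"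
  shows "\<exists>n p h. hnf_rows k n p h \<and> (\<forall>i<n. h i \<in> L) \<and>
    (\<forall>v\<in>L. \<exists>c. \<forall>j<k. v j = (\<Sum>i<n. c i * h i j))"
proof -
  have sum_in: "(\<lambda>j. v j + (\<Sum>r<m. c r * h r j)) \<in> L"
    if "v \<in> L" "\<forall>i<m. h i \<in> L" for v c m and h :: "nat \<Rightarrow> nat \<Rightarrow> int"
    using that(2)
  proof (induction m)
    case (Suc m)
    then have "(\<lambda>j. v j + (\<Sum>r<m. c r * h r j)) \<in> L" "h m \<in> L" by auto
    from add[OF this, of "c m"] show ?case by (simp add: add.assoc)
  qed (use that(1) in simp)
  \<comment> \<open>Here \<open>d\<close> counts columns from the right: only elements of
    \<open>L\<close> vanishing left of column \<open>k - d\<close> need to be generated so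
    far.\<close>
  have "\<exists>n p h. hnf_rows k n p h \<and> (\<forall>i<n. h i \<in> L \<and> k - d \<le> p i) \<and>
      (\<forall>v\<in>L. (\<forall>j<k - d. v j = 0) \<longrightarrow> (\<exists>c. \<forall>j<k. v j = (\<Sum>i<n. c i * h i j)))"
    if "d \<le> k" for d
    using that
  proof (induction d)
    case 0
    show ?case by (intro exI[of _ 0]) (auto simp: hnf_rows_def)
  next
    case (Suc d)
    then obtain n p h where h: "hnf_rows k n p h" "\<forall>i<n. h i \<in> L \<and> k - d \<le> p i"
      and span: "\<forall>v\<in>L. (\<forall>j<k - d. v j = 0) \<longrightarrow> (\<exists>c. \<forall>j<k. v j = (\<Sum>i<n. c i * h i j))"
      by auto
    define m where "m = k - Suc d"
    have kd: "k - d = Suc m" "k - Suc d = m" "m < k" using Suc.prems by (auto simp: m_def)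
    note h = h[unfolded kd] and span = span[unfolded kd]
    show ?case unfolding kd
    proof (cases "\<exists>v\<in>L. (\<forall>j<m. v j = 0) \<and> v m > 0")
      case False
      have "v m = 0" if v: "v \<in> L" "\<forall>j<m. v j = 0" for v
      proof (rule ccontr)
        assume "v m \<noteq> 0"
        moreover have "\<not> v m > 0" using False v by blast
        \<comment> \<open>The coefficient -2 produces \<open>- v\<close> as
          \<open>v - 2 v\<close>.\<close>
        moreover have "\<not> v m < 0" using add[OF v(1) v(1), of "-2"] False v(2) by force
        ultimately show False by linarith
      qed
      then have "\<forall>v\<in>L. (\<forall>j<m. v j = 0) \<longrightarrow> (\<exists>c. \<forall>j<k. v j = (\<Sum>i<n. c i * h i j))"
        using span by (simp add: less_Suc_eq)
      then show "\<exists>n p h. hnf_rows k n p h \<and> (\<forall>i<n. h i \<in> L \<and> m \<le> p i) \<and>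
          (\<forall>v\<in>L. (\<forall>j<m. v j = 0) \<longrightarrow> (\<exists>c. \<forall>j<k. v j = (\<Sum>i<n. c i * h i j)))"
        using h by (intro exI[of _ n] exI[of _ p] exI[of _ h]) auto
    next
      case True
      then obtain v0 where v0: "v0 \<in> L \<and> (\<forall>j<m. v0 j = 0) \<and> v0 m > 0" by blast
      obtain v where v: "v \<in> L" "\<forall>j<m. v j = 0" "v m > 0"
        and min: "\<And>u. u \<in> L \<Longrightarrow> \<forall>j<m. u j = 0 \<Longrightarrow> u m > 0 \<Longrightarrow> v m \<le> u m"
        using ex_has_least_nat[of "\<lambda>v. v \<in> L \<and> (\<forall>j<m. v j = 0) \<and> v m > 0", OF v0, of "\<lambda>v. nat (v m)"]
        by force
      obtain c where c: "\<forall>i<n. 0 \<le> v (p i) + (\<Sum>r<n. c r * h r (p i)) \<and>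
          v (p i) + (\<Sum>r<n. c r * h r (p i)) < h i (p i)"
        using hnf_rows_reduce[OF h(1)] by blast
      \<comment> \<open>The new top row must be reduced modulo the old pivots. Old rows vanish up to
        column \<open>m\<close>, so this keeps the leading zeros and the minimal entry.\<close>
      define v' where "v' j = v j + (\<Sum>r<n. c r * h r j)" for j
      have hz: "h r j = 0" if "r < n" "j \<le> m" for r j
        using h that by (auto simp: hnf_rows_def)
      have v': "v' \<in> L" "\<forall>j<m. v' j = 0" "v' m = v m"
        using sum_in[of v n h c] v h hz by (auto simp: v'_def[abs_def])
      \<comment> \<open>\<open>case_nat\<close> inserts the new row at index 0 and shifts the old
        ones by one.\<close>
      define p' where "p' = case_nat m p"
      define h' where "h' = case_nat v' h"
      have "hnf_rows k (Suc n) p' h'"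
        unfolding hnf_rows_def
      proof (intro allI impI)
        fix i assume "i < Suc n"
        then show "p' i < k \<and> h' i (p' i) > 0 \<and> (\<forall>j<p' i. h' i j = 0) \<and>
            (\<forall>i'<i. p' i' < p' i \<and> 0 \<le> h' i' (p' i) \<and> h' i' (p' i) < h' i (p' i))"
        proof (cases i)
          case 0
          then show ?thesis using v v' kd by (simp add: p'_def h'_def)
        next
          case (Suc i0)
          then have i0: "i0 < n" using \<open>i < Suc n\<close> by simp
          have "p' i' < p' i \<and> 0 \<le> h' i' (p' i) \<and> h' i' (p' i) < h' i (p' i)" if "i' < i" for i'
          proof (cases i')
            case 0
            then show ?thesis using i0 h(2) c Suc by (auto simp: p'_def h'_def v'_def)
          next
            case (Suc i1)
            then show ?thesis using i0 h(1) \<open>i = Suc i0\<close> that by (simp add: p'_def h'_def hnf_rows_def)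
          qed
          then show ?thesis
            using i0 h(1) Suc by (auto simp: p'_def h'_def hnf_rows_def)
        qed
      qed
      moreover have "\<forall>i<Suc n. h' i \<in> L \<and> m \<le> p' i"
        using h(2) v' by (auto simp: h'_def p'_def less_Suc_eq_0_disj)
      moreover have "\<exists>c. \<forall>j<k. w j = (\<Sum>i<Suc n. c i * h' i j)"
        if w: "w \<in> L" "\<forall>j<m. w j = 0" for w
      proof -
        \<comment> \<open>The remainder \<open>u m\<close> is smaller than the minimal positive
          entry, hence 0, and \<open>u\<close> falls under the induction hypothesis.\<close>
        define q where "q = w m div v m"
        define u where "u j = w j + (- q) * v' j" for j
        have um: "u m = w m mod v m"
          by (simp add: u_def v' q_def minus_div_mult_eq_mod[symmetric])
        have u: "u \<in> L" "\<forall>j<m. u j = 0"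
          using add[OF w(1) v'(1), of "- q"] w v' by (auto simp: u_def[abs_def])
        have "0 \<le> u m" "u m < v m" using v(3) by (simp_all add: um)
        then have "u m = 0" using min[OF u] by fastforce
        then obtain b where b: "\<forall>j<k. u j = (\<Sum>i<n. b i * h i j)"
          using span u less_Suc_eq by metis
        have "w j = (\<Sum>i<Suc n. case_nat q b i * h' i j)" if "j < k" for j
          using b that by (simp add: sum.lessThan_Suc_shift h'_def u_def algebra_simps del: sum.lessThan_Suc)
        then show ?thesis by blast
      qed
      ultimately show "\<exists>n p h. hnf_rows k n p h \<and> (\<forall>i<n. h i \<in> L \<and> m \<le> p i) \<and>
          (\<forall>v\<in>L. (\<forall>j<m. v j = 0) \<longrightarrow> (\<exists>c. \<forall>j<k. v j = (\<Sum>i<n. c i * h i j)))"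
        by (intro exI[of _ "Suc n"] exI[of _ p'] exI[of _ h'] conjI ballI impI) simp_all
    qed
  qed
  from this[OF order_refl] obtain n p h where "hnf_rows k n p h" "\<forall>i<n. h i \<in> L"
    "\<forall>v\<in>L. \<exists>c. \<forall>j<k. v j = (\<Sum>i<n. c i * h i j)"
    by auto
  then show ?thesis by (intro exI[of _ n] exI[of _ p] exI[of _ h] conjI)
qed

text \<open>Everything follows from the choice of \<open>L\<close>, the integer vectors in the real
  span of the rows of \<open>a\<close>. Those rows lie in \<open>L\<close>, which gives the integral
  \<open>C\<close>; the rows of \<open>h\<close> lie in \<open>L\<close>, which gives the real
  \<open>B\<close>; an integral vector in the real span of the rows of \<open>h\<close> is again in
  \<open>L\<close>, which gives saturation.\<close>

lemma saturated_hnf_factorization: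
  fixes a :: "nat \<Rightarrow> nat \<Rightarrow> int"
  obtains n p h C B where "hnf_rows k n p h"
    and "\<forall>i<l. \<forall>j<k. a i j = (\<Sum>r<n. C i r * h r j)"
    and "\<And>s r. s < n \<Longrightarrow> r < n \<Longrightarrow> (\<Sum>i<l. B s i * real_of_int (C i r)) = (if r = s then 1 else 0)"
    and "\<And>v y. \<forall>j<k. real_of_int (v j) = (\<Sum>r<n. y r * real_of_int (h r j)) \<Longrightarrow>
      \<exists>c. \<forall>j<k. v j = (\<Sum>r<n. c r * h r j)"
proof -
  define L where "L = {v :: nat \<Rightarrow> int. \<exists>y. \<forall>j<k. real_of_int (v j) = (\<Sum>i<l. y i * real_of_int (a i j))}"
  have add: "(\<lambda>j. v j + b * w j) \<in> L" if vw: "v \<in> L" "w \<in> L" for v w b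
  proof -
    obtain y where y: "\<forall>j<k. real_of_int (v j) = (\<Sum>i<l. y i * real_of_int (a i j))"
      using vw(1) unfolding L_def mem_Collect_eq ..
    obtain z where z: "\<forall>j<k. real_of_int (w j) = (\<Sum>i<l. z i * real_of_int (a i j))"
      using vw(2) unfolding L_def mem_Collect_eq ..
    have "real_of_int (v j + b * w j) = (\<Sum>i<l. (y i + b * z i) * real_of_int (a i j))"
      if "j < k" for j
    proof -
      have "real_of_int (v j + b * w j) = (\<Sum>i<l. y i * real_of_int (a i j)) +
          b * (\<Sum>i<l. z i * real_of_int (a i j))"
        using y z that by simp
      also have "\<dots> = (\<Sum>i<l. (y i + b * z i) * real_of_int (a i j))"
        unfolding sum_distrib_left sum.distrib[symmetric]
        by (rule sum.cong) (simp_all add: algebra_simps)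
      finally show ?thesis .
    qed
    then show ?thesis unfolding L_def by (intro CollectI exI allI impI)
  qed
  have "\<exists>n p h. hnf_rows k n p h \<and> (\<forall>i<n. h i \<in> L) \<and>
      (\<forall>v\<in>L. \<exists>c. \<forall>j<k. v j = (\<Sum>i<n. c i * h i j))"
    by (rule hnf_basis_of_subgroup) (rule add)
  then obtain n p h where h: "hnf_rows k n p h" "\<forall>i<n. h i \<in> L"
    and span: "\<forall>v\<in>L. \<exists>c. \<forall>j<k. v j = (\<Sum>i<n. c i * h i j)"
    by (elim exE conjE) (rule that)
  have "a i \<in> L" if "i < l" for i
  proof -
    have "\<forall>j<k. real_of_int (a i j) = (\<Sum>s<l. (if s = i then 1 else 0) * real_of_int (a s j))"
      using that by (simp add: if_distrib[of "\<lambda>x. x * _"] sum.delta cong: if_cong)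
    then show ?thesis unfolding L_def by (intro CollectI exI)
  qed
  then have "\<forall>i<l. \<exists>c. \<forall>j<k. a i j = (\<Sum>r<n. c r * h r j)"
    using span by simp
  then obtain C where C: "\<forall>i<l. \<forall>j<k. a i j = (\<Sum>r<n. C i r * h r j)" by metis
  have "\<forall>r<n. \<exists>y. \<forall>j<k. real_of_int (h r j) = (\<Sum>i<l. y i * real_of_int (a i j))"
    using h(2) unfolding L_def by simp
  then obtain B where B: "\<forall>r<n. \<forall>j<k. real_of_int (h r j) = (\<Sum>i<l. B r i * real_of_int (a i j))"
    by metis
  have swap: "(\<Sum>i<l. y i * real_of_int (a i j)) =
      (\<Sum>r<n. (\<Sum>i<l. y i * real_of_int (C i r)) * real_of_int (h r j))" if "j < k" for y j
  proof -
    have "(\<Sum>i<l. y i * real_of_int (a i j)) =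
        (\<Sum>i<l. \<Sum>r<n. y i * real_of_int (C i r) * real_of_int (h r j))"
      using C that by (simp add: sum_distrib_left mult.assoc)
    also have "\<dots> = (\<Sum>r<n. (\<Sum>i<l. y i * real_of_int (C i r)) * real_of_int (h r j))"
      by (subst sum.swap) (simp add: sum_distrib_right)
    finally show ?thesis .
  qed
  have BC: "(\<Sum>i<l. B s i * real_of_int (C i r)) = (if r = s then 1 else 0)" if "s < n" "r < n" for s r
  proof -
    \<comment> \<open>Row \<open>s\<close> of \<open>B C - 1\<close>. It annihilates
      \<open>h\<close> because \<open>B C h = B a = h\<close>, so independence makes it
      zero.\<close>
    define x where "x r = (\<Sum>i<l. B s i * real_of_int (C i r)) - (if r = s then 1 else 0)" for r
    have "\<forall>j<k. (\<Sum>r<n. x r * real_of_int (h r j)) = 0"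
    proof (intro allI impI)
      fix j assume "j < k"
      have "(\<Sum>r<n. x r * real_of_int (h r j)) =
          (\<Sum>r<n. (\<Sum>i<l. B s i * real_of_int (C i r)) * real_of_int (h r j)) - 
          (\<Sum>r<n. (if r = s then 1 else 0) * real_of_int (h r j))"
        by (simp add: x_def left_diff_distrib sum_subtractf)
      also have "(\<Sum>r<n. (if r = s then 1 else 0) * real_of_int (h r j)) = real_of_int (h s j)"
        using \<open>s < n\<close> by (simp add: if_distrib[of "\<lambda>x. x * _"] sum.delta cong: if_cong)
      finally show "(\<Sum>r<n. x r * real_of_int (h r j)) = 0"
        using B swap[OF \<open>j < k\<close>, of "B s"] \<open>s < n\<close> \<open>j < k\<close> by simp
    qed
    from hnf_rows_independent[OF h(1) this \<open>r < n\<close>] show ?thesis by (simp add: x_def)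
  qed
  have sat: "\<exists>c. \<forall>j<k. v j = (\<Sum>r<n. c r * h r j)"
    if v: "\<forall>j<k. real_of_int (v j) = (\<Sum>r<n. y r * real_of_int (h r j))" for v y
  proof -
    have "real_of_int (v j) = (\<Sum>i<l. (\<Sum>r<n. y r * B r i) * real_of_int (a i j))" if "j < k" for j
    proof -
      have "real_of_int (v j) = (\<Sum>r<n. \<Sum>i<l. y r * B r i * real_of_int (a i j))"
        using v B that by (simp add: sum_distrib_left mult.assoc)
      also have "\<dots> = (\<Sum>i<l. (\<Sum>r<n. y r * B r i) * real_of_int (a i j))"
        by (subst sum.swap) (simp add: sum_distrib_right)
      finally show ?thesis .
    qed
    then have "v \<in> L" unfolding L_def by (intro CollectI exI allI impI)
    then show ?thesis using span by simp
  qed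
  show ?thesis by (rule that[OF h(1) C BC sat])
qed

section \<open>From coefficient families to matrices: lattice, row space and rank\<close>

lemma lattice_of_rows:
  fixes H :: "int mat"
  assumes H: "H \<in> carrier_mat n k"
  shows "vec_module.lattice_of k (rows H) =
    {v \<in> carrier_vec k. \<exists>c. \<forall>j<k. v $ j = (\<Sum>i<n. c i * H $$ (i, j))}"
proof -
  interpret vec_module "TYPE(int)" k .
  let ?s = "\<lambda>c. sumlist (map (\<lambda>i. of_int (c i) \<cdot>\<^sub>v rows H ! i) [0..<length (rows H)])"
  have s: "?s c \<in> carrier_vec k" "\<forall>j<k. ?s c $ j = (\<Sum>i<n. c i * H $$ (i, j))" for c
  proof -
    show "?s c \<in> carrier_vec k"
      using H by (intro sumlist_carrier) auto
    show "\<forall>j<k. ?s c $ j = (\<Sum>i<n. c i * H $$ (i, j))"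
    proof (intro allI impI)
      fix j assume "j < k"
      have "?s c $ j = (\<Sum>i = 0..<n. map (\<lambda>i. of_int (c i) \<cdot>\<^sub>v rows H ! i) [0..<length (rows H)] ! i $ j)"
        using H \<open>j < k\<close> by (subst sumlist_nth) auto
      also have "\<dots> = (\<Sum>i<n. c i * H $$ (i, j))"
        using H \<open>j < k\<close> by (auto simp: atLeast0LessThan intro: sum.cong)
      finally show "?s c $ j = (\<Sum>i<n. c i * H $$ (i, j))" .
    qed
  qed
  show ?thesis
  proof (intro Set.set_eqI iffI)
    fix v assume "v \<in> lattice_of (rows H)"
    then obtain c where "v = ?s c" by (rule in_latticeE)
    then show "v \<in> {v \<in> carrier_vec k. \<exists>c. \<forall>j<k. v $ j = (\<Sum>i<n. c i * H $$ (i, j))}"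
      using s[of c] by auto
  next
    fix v assume "v \<in> {v \<in> carrier_vec k. \<exists>c. \<forall>j<k. v $ j = (\<Sum>i<n. c i * H $$ (i, j))}"
    then obtain c where v: "v \<in> carrier_vec k" "\<forall>j<k. v $ j = (\<Sum>i<n. c i * H $$ (i, j))" by auto
    have "v = ?s c"
      using v s[of c] by (intro eq_vecI) auto
    then show "v \<in> lattice_of (rows H)" by (rule in_latticeI)
  qed
qed

lemma mem_row_space:
  fixes M :: "real mat"
  assumes M: "M \<in> carrier_mat n k" and v: "v \<in> carrier_vec k"
  shows "v \<in> vec_space.row_space k M \<longleftrightarrow> (\<exists>y. \<forall>j<k. v $ j = (\<Sum>i<n. y i * M $$ (i, j)))"
proof -
  interpret vec_space "TYPE(real)" k .
  have *: "(M\<^sup>T *\<^sub>v y) $ j = (\<Sum>i<n. y $ i * M $$ (i, j))"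
    if "y \<in> carrier_vec n" "j < k" for y j
    using M that by (auto simp: scalar_prod_def atLeast0LessThan mult.commute intro: sum.cong)
  have "v \<in> row_space M \<longleftrightarrow> (\<exists>y\<in>carrier_vec n. M\<^sup>T *\<^sub>v y = v)"
    using M v by (auto simp: row_space_eq[OF M])
  also have "\<dots> \<longleftrightarrow> (\<exists>y. \<forall>j<k. v $ j = (\<Sum>i<n. y i * M $$ (i, j)))"
  proof
    assume "\<exists>y\<in>carrier_vec n. M\<^sup>T *\<^sub>v y = v"
    then obtain y where "y \<in> carrier_vec n" "M\<^sup>T *\<^sub>v y = v" ..
    then have "\<forall>j<k. v $ j = (\<Sum>i<n. y $ i * M $$ (i, j))"
      using *[of y] by auto
    then show "\<exists>y. \<forall>j<k. v $ j = (\<Sum>i<n. y i * M $$ (i, j))" by blast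
  next
    assume "\<exists>y. \<forall>j<k. v $ j = (\<Sum>i<n. y i * M $$ (i, j))"
    then obtain y where y: "\<forall>j<k. v $ j = (\<Sum>i<n. y i * M $$ (i, j))" ..
    have "M\<^sup>T *\<^sub>v vec n y = v"
    proof (rule eq_vecI)
      show "(M\<^sup>T *\<^sub>v vec n y) $ j = v $ j" if "j < dim_vec v" for j
        using that v y by (simp add: *)
    qed (use M v in auto)
    then show "\<exists>y\<in>carrier_vec n. M\<^sup>T *\<^sub>v y = v" by (intro bexI[of _ "vec n y"]) auto
  qed
  finally show ?thesis .
qed

text \<open>The pivot columns form a triangular matrix \<open>T\<close> with positive diagonal, so
  they are \<open>n\<close> independent columns. No independent set in dimension \<open>n\<close> is
  larger, so they are maximal among the columns and their number is the rank.\<close>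

lemma hnf_rows_rank:
  assumes h: "hnf_rows k n p h"
  shows "vec_space.rank n (map_mat real_of_int (mat n k (\<lambda>(i, j). h i j))) = n"
proof -
  interpret vec_space "TYPE(real)" n .
  let ?A = "map_mat real_of_int (mat n k (\<lambda>(i, j). h i j))"
  define T where "T = mat n n (\<lambda>(i, j). real_of_int (h i (p j)))"
  have T: "T \<in> carrier_mat n n" by (simp add: T_def)
  have A: "?A \<in> carrier_mat n k" by simp
  \<comment> \<open>Below the diagonal \<open>j < i\<close>, so column \<open>p j\<close> lies left
    of the pivot of row \<open>i\<close>.\<close>
  have "upper_triangular T"
    using h by (auto simp: T_def hnf_rows_def)
  then have "det T = prod_list (diag_mat T)"
    using T by (rule det_upper_triangular)
  moreover have "0 \<notin> set (diag_mat T)"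
    using h by (auto simp: T_def diag_mat_def hnf_rows_def)
  ultimately have "det T \<noteq> 0" by (simp add: prod_list_zero_iff)
  then have rank: "rank T = n" using det_rank_iff[OF T] by simp
  then have dist: "distinct (cols T)" using non_distinct_low_rank[OF T] by auto
  let ?U = "set (cols T)"
  have indpt: "lin_indpt ?U" by (rule full_rank_lin_indpt[OF T rank dist])
  have card: "card ?U = n" using dist T by (simp add: distinct_card)
  have sub: "?U \<subseteq> set (cols ?A)"
  proof
    fix x assume "x \<in> ?U"
    then obtain j where j: "j < n" "x = col T j"
      using T by (auto simp: cols_def)
    then have "p j < k" using h by (simp add: hnf_rows_def)
    moreover have "x = col ?A (p j)"
      using j \<open>p j < k\<close> by (auto simp: T_def intro!: eq_vecI)
    ultimately show "x \<in> set (cols ?A)" by (auto simp: cols_def)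
  qed
  have "maximal ?U (\<lambda>W. W \<subseteq> set (cols ?A) \<and> lin_indpt W)"
    unfolding maximal_def
  proof (intro conjI allI impI)
    fix W assume W: "?U \<subseteq> W \<and> W \<subseteq> set (cols ?A) \<and> lin_indpt W"
    then have "W \<subseteq> carrier_vec n" using cols_dim[of ?A] A by auto
    then have "finite W" "card W \<le> n"
      using li_le_dim[of W] W by (auto simp: dim_is_n)
    then show "W = ?U" using W card card_seteq[of W ?U] by auto
  qed (use sub indpt in auto)
  then show ?thesis using rank_card_indpt[OF A] card by simp
qed

lemma saturated_hnf_mat:
  assumes h: "hnf_rows k n p h"
    and sat: "\<And>v y. \<forall>j<k. real_of_int (v j) = (\<Sum>r<n. y r * real_of_int (h r j)) \<Longrightarrow>
      \<exists>c. \<forall>j<k. v j = (\<Sum>r<n. c r * h r j)"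
  shows "saturated_hnf (mat n k (\<lambda>(i, j). h i j))" (is "saturated_hnf ?H")
proof (cases "n = 0")
  case False
  have p: "p i < k" "h i (p i) > 0" "\<forall>j<p i. h i j = 0"
      "\<forall>i'<i. p i' < p i \<and> 0 \<le> h i' (p i) \<and> h i' (p i) < h i (p i)" if "i < n" for i
    using h that by (auto simp: hnf_rows_def)
  have "hermite_normal_form ?H"
    unfolding hermite_normal_form_def
  proof (rule conjI, goal_cases)
    case 1
    have "?H $$ (0, p 0) \<noteq> 0" using False p[of 0] by simp
    moreover have "0\<^sub>m n k $$ (0, p 0) = (0 :: int)" using False p[of 0] by simp
    ultimately show ?case by (metis dim_row_mat(1) dim_col_mat(1))
  next
    case 2
    have z: "?H $$ (i, j) = 0" if "i < n" "j < p i" for i j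
      using p[OF that(1)] that by simp
    have "p 0 \<le> p i" if "i < n" for i
      using p(4)[OF that] by (cases "i = 0") auto
    then have "\<forall>i<n. \<forall>j<p 0. ?H $$ (i, j) = 0" using z by fastforce
    moreover have "strict_mono_on {..<n} p" using p(4) by (auto simp: strict_mono_on_def)
    moreover have "\<forall>i<n. p i < k \<and> ?H $$ (i, p i) > 0 \<and> (\<forall>j<p i. ?H $$ (i, j) = 0) \<and>
        (\<forall>i'<i. 0 \<le> ?H $$ (i', p i) \<and> ?H $$ (i', p i) < ?H $$ (i, p i))"
      using p(1,2,4) z by simp
    \<comment> \<open>Exactly the columns left of the first pivot are declared zero, and no bottom
      rows are.\<close>
    ultimately show ?case using False p(1)[of 0]
      by (rule_tac exI[of _ "p 0"], rule_tac exI[of _ "0 :: nat"], rule_tac exI[of _ p]) simp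
  qed
  moreover have "{v \<in> carrier_vec (dim_col ?H).
        map_vec real_of_int v \<in> vec_space.row_space (dim_col ?H) (map_mat real_of_int ?H)} =
      vec_module.lattice_of (dim_col ?H) (rows ?H)"
  proof -
    have H: "?H \<in> carrier_mat n k" "map_mat real_of_int ?H \<in> carrier_mat n k" by auto
    have "(map_vec real_of_int v \<in> vec_space.row_space k (map_mat real_of_int ?H)) =
        (\<exists>c. \<forall>j<k. v $ j = (\<Sum>i<n. c i * ?H $$ (i, j)))" if v: "v \<in> carrier_vec k" for v
    proof -
      have "(map_vec real_of_int v \<in> vec_space.row_space k (map_mat real_of_int ?H)) \<longleftrightarrow>
          (\<exists>y. \<forall>j<k. real_of_int (v $ j) = (\<Sum>r<n. y r * real_of_int (h r j)))"
        using v by (subst mem_row_space[OF H(2)]) auto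
      \<comment> \<open>Integer coefficients are real ones; the converse is the saturation
        hypothesis.\<close>
      also have "\<dots> \<longleftrightarrow> (\<exists>c. \<forall>j<k. v $ j = (\<Sum>r<n. c r * h r j))"
      proof
        assume "\<exists>c. \<forall>j<k. v $ j = (\<Sum>r<n. c r * h r j)"
        then obtain c where "\<forall>j<k. v $ j = (\<Sum>r<n. c r * h r j)" ..
        then have "\<forall>j<k. real_of_int (v $ j) = (\<Sum>r<n. real_of_int (c r) * real_of_int (h r j))"
          by simp
        then show "\<exists>y. \<forall>j<k. real_of_int (v $ j) = (\<Sum>r<n. y r * real_of_int (h r j))"
          by (intro exI)
      next
        assume "\<exists>y. \<forall>j<k. real_of_int (v $ j) = (\<Sum>r<n. y r * real_of_int (h r j))"
        then show "\<exists>c. \<forall>j<k. v $ j = (\<Sum>r<n. c r * h r j)" using sat by (elim exE)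
      qed
      finally show ?thesis by simp
    qed
    then show ?thesis using lattice_of_rows[OF H(1)] by (auto simp del: index_mat)
  qed
  ultimately show ?thesis by (simp add: saturated_hnf_def)
qed (simp add: saturated_hnf_def)

section \<open>Reduction of an arbitrary matrix to saturated Hermite form\<close>

lemma mahler_measure_saturated_hnf:
  assumes F: "F \<in> laurent_polys k" and A: "A \<in> carrier_mat l k" and nz: "laurent_subst F A \<noteq> 0"
  obtains n H where "n \<le> k" "H \<in> carrier_mat n k" "vec_space.rank n (map_mat real_of_int H) = n"
    "saturated_hnf H" "laurent_subst F H \<noteq> 0"
    "mahler_measure l (laurent_subst F A) = mahler_measure n (laurent_subst F H)"
proof -
  obtain n p h C B where h: "hnf_rows k n p h"
    and AC: "\<forall>i<l. \<forall>j<k. A $$ (i, j) = (\<Sum>r<n. C i r * h r j)"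
    and BC: "\<And>s r. s < n \<Longrightarrow> r < n \<Longrightarrow>
      (\<Sum>i<l. B s i * real_of_int (C i r)) = (if r = s then 1 else 0)"
    and sat: "\<And>v y. \<forall>j<k. real_of_int (v j) = (\<Sum>r<n. y r * real_of_int (h r j)) \<Longrightarrow>
      \<exists>c. \<forall>j<k. v j = (\<Sum>r<n. c r * h r j)"
    by (rule saturated_hnf_factorization[of k l "\<lambda>i j. A $$ (i, j)"]) (rule that)
  define H where "H = mat n k (\<lambda>(i, j). h i j)"
  define D where "D = mat l n (\<lambda>(i, r). C i r)"
  have H: "H \<in> carrier_mat n k" and D: "D \<in> carrier_mat l n" by (auto simp: H_def D_def)
  have "A = D * H"
    by (rule eq_matI) (use A AC in \<open>auto simp: H_def D_def scalar_prod_def atLeast0LessThan\<close>)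
  then have FA: "laurent_subst F A = laurent_subst (laurent_subst F H) D"
    using laurent_subst_mult[of D H F] H D by simp
  show thesis
  proof (rule that)
    show "n \<le> k" using h by (rule hnf_rows_imp_le)
    show "vec_space.rank n (map_mat real_of_int H) = n"
      unfolding H_def using h by (rule hnf_rows_rank)
    show "saturated_hnf H"
      unfolding H_def using h sat by (rule saturated_hnf_mat)
    \<comment> \<open>Substitution sends 0 to 0, so nonvanishing passes from \<open>F_A\<close> back
      to \<open>F_H\<close>.\<close>
    show "laurent_subst F H \<noteq> 0" using nz FA by auto
    have "laurent_subst F H \<in> laurent_polys n"
      using laurent_subst_in_laurent_polys[of F H] H by simp
    then show "mahler_measure l (laurent_subst F A) = mahler_measure n (laurent_subst F H)"
      unfolding FA
    proof (rule mahler_measure_subst_surj[OF D])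
      fix w :: "nat \<Rightarrow> complex" assume "\<forall>j<n. cmod (w j) = 1"
      then show "\<exists>v. (\<forall>i<l. cmod (v i) = 1) \<and> (\<forall>j<n. w j = monomial_map D v j)"
        by (intro monomial_map_surj[OF D, where B = B]) (simp_all add: D_def BC)
    qed
  qed fact
qed

theorem theorem4:
  fixes k :: nat and F :: laurent
  assumes "k \<ge> 1" and "F \<in> laurent_polys k" and "F \<noteq> 0"
  shows "mahler_set k F =
    {mahler_measure l (laurent_subst F H) | l H.
       l \<le> k \<and> H \<in> carrier_mat l k \<and>
       vec_space.rank l (map_mat real_of_int H) = l \<and>
       saturated_hnf H \<and> laurent_subst F H \<noteq> 0}"
    (is "_ = ?R")
proof (intro subset_antisym subsetI)
  fix x assume "x \<in> mahler_set k F"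
  then obtain l A where A: "A \<in> carrier_mat l k" "laurent_subst F A \<noteq> 0"
    and x: "x = mahler_measure l (laurent_subst F A)"
    unfolding mahler_set_def by blast
  obtain n H where "n \<le> k" "H \<in> carrier_mat n k" "vec_space.rank n (map_mat real_of_int H) = n"
    "saturated_hnf H" "laurent_subst F H \<noteq> 0"
    "mahler_measure l (laurent_subst F A) = mahler_measure n (laurent_subst F H)"
    using mahler_measure_saturated_hnf[OF assms(2) A] by blast
  then show "x \<in> ?R" unfolding x by blast
\<comment> \<open>The reverse inclusion is immediate, as the matrices on the right are among those
  defining \<open>mahler_set\<close>.\<close>
qed (auto simp: mahler_set_def)

end
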